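(* Assume $\mathsf{MA}(\sigma\text{-centered})$. Let $\mathcal{I}$ be any proper ideal on $\omega$ containing $\mathrm{Fin}$. Then there is a finitely $\mathcal{I}_0$-productive maximal eventually different family $\mathcal{F} \subseteq {}^{\omega}\omega$ with $\mathcal{I}_0(\mathcal{F}) = \mathcal{I}$.
   Context: $\mathsf{MA}(\sigma\text{-centered})$ is Martin's Axiom restricted to $\sigma$-centered forcing notions (for fewer than $\mathfrak{c} = 2^{\aleph_0}$ many dense sets). $\mathrm{Fin}$ is the ideal of finite subsets of $\omega$, and $[\omega]^{\omega}$ is the set of infinite subsets of $\omega$. An ideal on $\omega$ is proper if it does not contain $\omega$. For countable sets $A,B$ and $f,g \in {}^{A}B$ (functions from $A$ to $B$) let $E(f,g) := \{a \in A \mid f(a) = g(a)\}$; $f$ and $g$ are eventually different if $E(f,g)$ is finite. A family $\mathcal{F} \subseteq {}^{A}B$ is eventually different (ed) if its members are pairwise eventually different, and it is maximal eventually different (med) if it is maximal with respect to inclusion among ed families contained in ${}^{A}B$. For functions $f_1,\dots,f_n$ with the same domain, $(f_1\times\dots\times f_n)(a) := (f_1(a),\dots,f_n(a))$. For a family $\mathcal{F} \subseteq {}^{A}B$ and $n \geq 1$, $\mathcal{F}^n := \{f_1 \times \dots \times f_n \mid f_1,\dots,f_n \in \mathcal{F}\} \subseteq {}^{A}(B^n)$. For an ed family $\mathcal{F} \subseteq {}^{\omega}B$ ($B$ countable) and $A \in [\omega]^\omega$ let $\mathcal{F}\restriction A := \{f \restriction A \mid f \in \mathcal{F}\}$. The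 associated ideal is $\mathcal{I}_0(\mathcal{F}) := \{A \in [\omega]^{\omega} \mid \mathcal{F} \restriction A \text{ is not a maximal ed family in } {}^{A}B\} \cup \mathrm{Fin}$. A med family $\mathcal{F} \subseteq {}^\omega\omega$ is finitely $\mathcal{I}_0$-productive if $\mathcal{I}_0(\mathcal{F}^n) = \mathcal{I}_0(\mathcal{F})$ for all $n \geq 1$. *)

theory Defs
  imports "HOL-Library.FuncSet"
begin

unbundle cardinal_syntax

section \<open>Martin's Axiom for sigma-centered forcing notions\<close>

text \<open>A forcing notion is a nonempty preorder \<open>r\<close> on a set \<open>P\<close>, where \<open>(q, p) \<in> r\<close> means
  \<open>q \<le> p\<close>, i.e. \<open>q\<close> is the stronger condition.\<close>

definition forcing_notion :: "'p set \<Rightarrow> 'p rel \<Rightarrow> bool" where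
  "forcing_notion P r \<longleftrightarrow> P \<noteq> {} \<and> preorder_on P r"

definition forcing_dense :: "'p set \<Rightarrow> 'p rel \<Rightarrow> 'p set \<Rightarrow> bool" where
  "forcing_dense P r D \<longleftrightarrow> D \<subseteq> P \<and> (\<forall>p\<in>P. \<exists>d\<in>D. (d, p) \<in> r)"

definition centered :: "'p set \<Rightarrow> 'p rel \<Rightarrow> 'p set \<Rightarrow> bool" where
  "centered P r C \<longleftrightarrow> C \<subseteq> P \<and> (\<forall>F. finite F \<and> F \<subseteq> C \<longrightarrow> (\<exists>q\<in>P. \<forall>p\<in>F. (q, p) \<in> r))"

definition sigma_centered :: "'p set \<Rightarrow> 'p rel \<Rightarrow> bool" where
  "sigma_centered P r \<longleftrightarrow> (\<exists>C :: nat \<Rightarrow> 'p set. P = (\<Union>n. C n) \<and> (\<forall>n. centered P r (C n)))"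

definition forcing_filter :: "'p set \<Rightarrow> 'p rel \<Rightarrow> 'p set \<Rightarrow> bool" where
  "forcing_filter P r G \<longleftrightarrow> G \<subseteq> P \<and> G \<noteq> {} \<and>
     (\<forall>p\<in>G. \<forall>q\<in>P. (p, q) \<in> r \<longrightarrow> q \<in> G) \<and>
     (\<forall>p\<in>G. \<forall>q\<in>G. \<exists>s\<in>G. (s, p) \<in> r \<and> (s, q) \<in> r)"

text \<open>\<open>MA_for P r\<close>: every family of fewer than continuum many dense subsets of \<open>P\<close> is met by a
  filter. Cardinalities on different types are compared by \<open><o\<close>; the continuum is the
  cardinality of \<open>UNIV :: nat set set\<close>.\<close>

definition MA_for :: "'p set \<Rightarrow> 'p rel \<Rightarrow> bool" where
  "MA_for P r \<longleftrightarrow>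
     (\<forall>\<D> :: 'p set set. |\<D>| <o |UNIV :: nat set set| \<and> (\<forall>D\<in>\<D>. forcing_dense P r D) \<longrightarrow>
        (\<exists>G. forcing_filter P r G \<and> (\<forall>D\<in>\<D>. G \<inter> D \<noteq> {})))"

text \<open>HOL cannot quantify over all types inside a formula, so the axiom is stated for the forcing
  notions carried by sets of elements of \<open>nat set\<close>, i.e. up to isomorphism all those of size at
  most continuum. This is no restriction: \<open>MA_sigma_centeredD\<close> below derives the axiom for
  forcing notions on an arbitrary type.\<close>

definition MA_sigma_centered :: bool where
  "MA_sigma_centered \<longleftrightarrow>
     (\<forall>(P :: nat set set) r. forcing_notion P r \<and> sigma_centered P r \<longrightarrow> MA_for P r)"

lemma card_of_finite_subsets_le:
  assumes "|X :: 'a set| \<le>o |UNIV :: nat set set|"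
  shows "|{F. finite F \<and> F \<subseteq> X}| \<le>o |UNIV :: nat set set|"
proof -
  have inf: "\<not> finite (UNIV :: nat set set)"
    by (simp add: Finite_Set.finite_set)
  let ?L = "\<lambda>n. {xs. length xs = n \<and> set xs \<subseteq> X}"
  have L: "|?L n| \<le>o |UNIV :: nat set set|" for n
  proof (induction n)
    case 0
    have "?L 0 = {[]}" by auto
    moreover have "|{[] :: 'a list}| \<le>o |UNIV :: nat set set|"
      by (rule card_of_ordLeqI[where f = "\<lambda>_. {}"]) auto
    ultimately show ?case by simp
  next
    case (Suc n)
    have eq: "?L (Suc n) = (\<lambda>(x, xs). x # xs) ` (X \<times> ?L n)"
      by (auto simp: length_Suc_conv image_iff)
    have "|X \<times> ?L n| \<le>o |UNIV :: nat set set|"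
      by (rule card_of_Times_ordLeq_infinite_Field[OF _ assms Suc card_of_Card_order])
         (simp add: inf Field_card_of)
    then show ?case
      unfolding eq by (rule ordLeq_transitive[OF card_of_image])
  qed
  have nat: "|UNIV :: nat set| \<le>o |UNIV :: nat set set|"
    using inf infinite_iff_card_of_nat by blast
  have L_all: "|\<Union>n\<in>UNIV. ?L n| \<le>o |UNIV :: nat set set|"
    by (rule card_of_UNION_ordLeq_infinite[OF inf nat]) (use L in blast)
  have "{F. finite F \<and> F \<subseteq> X} \<subseteq> set ` (\<Union>n\<in>UNIV. ?L n)"
  proof
    fix F assume "F \<in> {F. finite F \<and> F \<subseteq> X}"
    then obtain xs where "set xs = F" "F \<subseteq> X"
      using finite_list by blast
    then show "F \<in> set ` (\<Union>n\<in>UNIV. ?L n)" by (auto intro!: image_eqI[of _ _ xs])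
  qed
  from card_of_mono1[OF this] show ?thesis
    by (rule ordLeq_transitive[OF _ ordLeq_transitive[OF card_of_image L_all]])
qed

theorem MA_sigma_centeredD:
  fixes P :: "'p set"
  assumes MA: MA_sigma_centered and fn: "forcing_notion P r" and sc: "sigma_centered P r"
  shows "MA_for P r"
  unfolding MA_for_def
proof (intro allI impI, elim conjE)
  fix \<D> :: "'p set set"
  assume small: "|\<D>| <o |UNIV :: nat set set|" and dense: "\<forall>D\<in>\<D>. forcing_dense P r D"
  let ?c = "|UNIV :: nat set set|"
  have inf: "\<not> finite (UNIV :: nat set set)"
    by (simp add: Finite_Set.finite_set)
  have nat: "|UNIV :: nat set| \<le>o ?c"
    using inf infinite_iff_card_of_nat by blast
  obtain p0 where p0: "p0 \<in> P" using fn by (auto simp: forcing_notion_def)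
  have rP: "r \<subseteq> P \<times> P" and refl: "\<And>p. p \<in> P \<Longrightarrow> (p, p) \<in> r" and tr: "trans r"
    using fn by (auto simp: forcing_notion_def preorder_on_def refl_on_def)
  obtain C :: "nat \<Rightarrow> 'p set" where "P = (\<Union>n. C n) \<and> (\<forall>n. centered P r (C n))"
    using sc unfolding sigma_centered_def by (elim exE)
  then have C: "P = (\<Union>n. C n)" "\<And>n. centered P r (C n)"
    by (rule conjunct1, elim conjE allE)
  define e where "e D p = (SOME d. d \<in> D \<and> (d, p) \<in> r)" for D p
  have e: "e D p \<in> D \<and> (e D p, p) \<in> r" if "D \<in> \<D>" "p \<in> P" for D p
    unfolding e_def by (rule someI_ex) (use that dense in \<open>unfold forcing_dense_def, blast\<close>)
  define m where "m F = (SOME q. q \<in> P \<and> ((\<exists>n. F \<subseteq> C n) \<longrightarrow> (\<forall>p\<in>F. (q, p) \<in> r)))" for F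
  have m: "m F \<in> P \<and> ((\<exists>n. F \<subseteq> C n) \<longrightarrow> (\<forall>p\<in>F. (m F, p) \<in> r))" if "finite F" for F
    unfolding m_def
    by (rule someI_ex) (use that C(2) p0 in \<open>unfold centered_def, blast\<close>)
  define step where
    "step X = X \<union> ((\<lambda>(D, p). e D p) ` (\<D> \<times> X) \<union> m ` {F. finite F \<and> F \<subseteq> X})" for X
  define Qn where "Qn n = (step ^^ n) {p0}" for n
  define Q where "Q = (\<Union>n. Qn n)"
  have Qn_Suc: "Qn (Suc n) = step (Qn n)" for n by (simp add: Qn_def)
  have un: "|A \<union> B| \<le>o ?c" if "|A| \<le>o ?c" "|B| \<le>o ?c" for A B :: "'p set"
    by (rule card_of_Un_ordLeq_infinite_Field[OF _ that card_of_Card_order]) (simp add: inf Field_card_of)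
  have Qn: "Qn n \<subseteq> P \<and> |Qn n| \<le>o ?c" for n
  proof (induction n)
    case 0
    have "|{p0}| \<le>o ?c" by (rule card_of_ordLeqI[where f = "\<lambda>_. {}"]) auto
    then show ?case using p0 by (simp add: Qn_def)
  next
    case (Suc n)
    have "|\<D> \<times> Qn n| \<le>o ?c"
      by (rule card_of_Times_ordLeq_infinite_Field[OF _ ordLess_imp_ordLeq[OF small]
            conjunct2[OF Suc] card_of_Card_order]) (simp add: inf Field_card_of)
    then have 1: "|(\<lambda>(D, p). e D p) ` (\<D> \<times> Qn n)| \<le>o ?c"
      using card_of_image ordLeq_transitive by blast
    have 2: "|m ` {F. finite F \<and> F \<subseteq> Qn n}| \<le>o ?c"
      using card_of_image card_of_finite_subsets_le Suc ordLeq_transitive by blast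
    have "|step (Qn n)| \<le>o ?c"
      unfolding step_def using un 1 2 Suc by blast
    moreover have "step (Qn n) \<subseteq> P"
    proof
      fix x assume "x \<in> step (Qn n)"
      then consider "x \<in> Qn n" | D p where "D \<in> \<D>" "p \<in> Qn n" "x = e D p" | F where "finite F" "x = m F"
        by (auto simp: step_def)
      then show "x \<in> P"
      proof cases
        case 1 then show ?thesis using Suc by blast
      next
        case 2 then show ?thesis using e[of D p] Suc rP by auto
      next
        case 3 then show ?thesis using m by blast
      qed
    qed
    ultimately show ?case by (simp add: Qn_Suc)
  qed
  have QP: "Q \<subseteq> P" using Qn by (auto simp: Q_def)
  have p0Q: "p0 \<in> Q" by (auto simp: Q_def Qn_def intro!: exI[of _ 0])
  have "|Q| \<le>o ?c"
    unfolding Q_def by (rule card_of_UNION_ordLeq_infinite[OF inf nat]) (use Qn in blast)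
  then obtain h :: "'p \<Rightarrow> nat set" where h: "inj_on h Q"
    unfolding card_of_ordLeq[symmetric] by blast
  have eQ: "e D p \<in> Q" if Dp: "D \<in> \<D>" "p \<in> Q" for D p
  proof -
    obtain n where "p \<in> Qn n" using Dp by (auto simp: Q_def)
    then have "e D p \<in> Qn (Suc n)" using Dp by (auto simp: Qn_Suc step_def)
    then show ?thesis by (auto simp: Q_def)
  qed
  have mono: "Qn i \<subseteq> Qn j" if "i \<le> j" for i j
    using that by (induction rule: dec_induct) (auto simp: Qn_Suc step_def)
  have mQ: "m F \<in> Q" if F: "finite F" "F \<subseteq> Q" for F
  proof -
    from F have "\<exists>n. F \<subseteq> Qn n"
    proof (induction F rule: finite_induct)
      case (insert x F)
      then obtain i j where "F \<subseteq> Qn i" "x \<in> Qn j" by (auto simp: Q_def)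
      then have "insert x F \<subseteq> Qn (max i j)"
        using mono[of i "max i j"] mono[of j "max i j"] by auto
      then show ?case by blast
    qed auto
    then obtain n where "F \<subseteq> Qn n" by blast
    then have "m F \<in> Qn (Suc n)" using F by (auto simp: Qn_Suc step_def)
    then show ?thesis by (auto simp: Q_def)
  qed
  define r' where "r' = {(h p, h q) | p q. p \<in> Q \<and> q \<in> Q \<and> (p, q) \<in> r}"
  have r'[simp]: "(h p, h q) \<in> r' \<longleftrightarrow> (p, q) \<in> r" if "p \<in> Q" "q \<in> Q" for p q
    using that unfolding r'_def by (auto dest: inj_onD[OF h])
  have "forcing_notion (h ` Q) r'"
    unfolding forcing_notion_def preorder_on_def refl_on_def
  proof (intro conjI)
    show "trans r'"
    proof (rule transI)
      fix x y z assume "(x, y) \<in> r'" "(y, z) \<in> r'"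
      then obtain p q s where "x = h p" "y = h q" "z = h s" "p \<in> Q" "q \<in> Q" "s \<in> Q"
        "(p, q) \<in> r" "(q, s) \<in> r"
        unfolding r'_def by (auto dest: inj_onD[OF h])
      then show "(x, z) \<in> r'" using transD[OF tr] by auto
    qed
  qed (use p0Q refl QP in \<open>auto simp: r'_def\<close>)
  moreover have "sigma_centered (h ` Q) r'"
    unfolding sigma_centered_def
  proof (intro exI[of _ "\<lambda>n. h ` (C n \<inter> Q)"] conjI allI)
    show "h ` Q = (\<Union>n. h ` (C n \<inter> Q))" using QP C(1) by blast
    show "centered (h ` Q) r' (h ` (C n \<inter> Q))" for n
      unfolding centered_def
    proof (intro conjI allI impI)
      fix F assume F: "finite F \<and> F \<subseteq> h ` (C n \<inter> Q)"
      then obtain F0 where F0: "F0 \<subseteq> C n \<inter> Q" "finite F0" "F = h ` F0"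
        by (meson finite_subset_image)
      have "m F0 \<in> Q" "\<forall>p\<in>F0. (m F0, p) \<in> r" using mQ[of F0] m[of F0] F0 by auto
      then have "\<forall>p\<in>F. (h (m F0), p) \<in> r'" using F0 by auto
      then show "\<exists>q\<in>h ` Q. \<forall>p\<in>F. (q, p) \<in> r'" using \<open>m F0 \<in> Q\<close> by blast
    qed auto
  qed
  ultimately have MAQ: "MA_for (h ` Q) r'" using MA by (simp add: MA_sigma_centered_def)
  let ?D' = "(\<lambda>D. h ` (D \<inter> Q)) ` \<D>"
  have "|?D'| <o ?c" using card_of_image small ordLeq_ordLess_trans by blast
  moreover have "\<forall>D\<in>?D'. forcing_dense (h ` Q) r' D"
  proof
    fix D' assume "D' \<in> ?D'"
    then obtain D where D: "D \<in> \<D>" "D' = h ` (D \<inter> Q)" by blast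
    show "forcing_dense (h ` Q) r' D'"
      unfolding forcing_dense_def
    proof (intro conjI ballI)
      fix x assume "x \<in> h ` Q"
      then obtain p where p: "p \<in> Q" "x = h p" by blast
      have ep: "e D p \<in> D" "(e D p, p) \<in> r" "e D p \<in> Q" using e[of D p] eQ[of D p] D p QP by auto
      then have "h (e D p) \<in> D'" "(h (e D p), x) \<in> r'" using D p by auto
      then show "\<exists>d\<in>D'. (d, x) \<in> r'" by blast
    qed (use D in auto)
  qed
  ultimately have "\<exists>G'. forcing_filter (h ` Q) r' G' \<and> (\<forall>D\<in>?D'. G' \<inter> D \<noteq> {})"
    using MAQ[unfolded MA_for_def, rule_format, of ?D'] by simp
  then obtain G' where G': "forcing_filter (h ` Q) r' G'" "\<forall>D\<in>?D'. G' \<inter> D \<noteq> {}"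
    by (elim exE conjE)
  have G'Q: "G' \<subseteq> h ` Q" and G'_ne: "G' \<noteq> {}"
    and G'_dir: "\<And>x y. x \<in> G' \<Longrightarrow> y \<in> G' \<Longrightarrow> \<exists>s\<in>G'. (s, x) \<in> r' \<and> (s, y) \<in> r'"
    using G'(1) by (simp_all add: forcing_filter_def)
  define G where "G = {p \<in> P. \<exists>q\<in>Q. h q \<in> G' \<and> (q, p) \<in> r}"
  have "forcing_filter P r G"
    unfolding forcing_filter_def
  proof (intro conjI ballI impI)
    obtain q where "q \<in> Q" "h q \<in> G'" using G'Q G'_ne by blast
    then show "G \<noteq> {}" using QP refl by (auto simp: G_def)
    show "q \<in> G" if "p \<in> G" "q \<in> P" "(p, q) \<in> r" for p q
      using that transD[OF tr] by (auto simp: G_def)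
    fix p q assume "p \<in> G" "q \<in> G"
    then obtain a b where ab: "a \<in> Q" "h a \<in> G'" "(a, p) \<in> r" "b \<in> Q" "h b \<in> G'" "(b, q) \<in> r"
      by (auto simp: G_def)
    then obtain y where y: "y \<in> G'" "(y, h a) \<in> r'" "(y, h b) \<in> r'"
      using G'_dir[of "h a" "h b"] by blast
    then obtain s where s: "s \<in> Q" "y = h s" using G'Q by blast
    then have "(s, a) \<in> r" "(s, b) \<in> r" using y ab by auto
    then have "(s, p) \<in> r" "(s, q) \<in> r" using ab transD[OF tr] by blast+
    moreover have "s \<in> G" using s y QP refl by (auto simp: G_def)
    ultimately show "\<exists>s\<in>G. (s, p) \<in> r \<and> (s, q) \<in> r" by blast
  qed (auto simp: G_def)
  moreover have "G \<inter> D \<noteq> {}" if "D \<in> \<D>" for D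
  proof -
    have "G' \<inter> h ` (D \<inter> Q) \<noteq> {}" using G'(2) that by blast
    then obtain p where "p \<in> D" "p \<in> Q" "h p \<in> G'" by blast
    then have "p \<in> G" using QP refl by (auto simp: G_def)
    then show ?thesis using \<open>p \<in> D\<close> by blast
  qed
  ultimately show "\<exists>G. forcing_filter P r G \<and> (\<forall>D\<in>\<D>. G \<inter> D \<noteq> {})" by blast
qed


section \<open>Eventually different families\<close>

text \<open>Functions from \<open>A\<close> to \<open>B\<close> are the elements of \<open>A \<rightarrow>\<^sub>E B\<close>, so that equality of functions is
  equality on \<open>A\<close>; for \<open>A = UNIV\<close> and \<open>B = UNIV\<close> this is the whole function type.\<close>

definition agree_set :: "'a set \<Rightarrow> ('a \<Rightarrow> 'b) \<Rightarrow> ('a \<Rightarrow> 'b) \<Rightarrow> 'a set" where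
  "agree_set A f g = {a \<in> A. f a = g a}"

definition eventually_different :: "'a set \<Rightarrow> ('a \<Rightarrow> 'b) \<Rightarrow> ('a \<Rightarrow> 'b) \<Rightarrow> bool" where
  "eventually_different A f g \<longleftrightarrow> finite (agree_set A f g)"

definition ed_family :: "'a set \<Rightarrow> 'b set \<Rightarrow> ('a \<Rightarrow> 'b) set \<Rightarrow> bool" where
  "ed_family A B \<F> \<longleftrightarrow> \<F> \<subseteq> A \<rightarrow>\<^sub>E B \<and> pairwise (eventually_different A) \<F>"

definition med_family :: "'a set \<Rightarrow> 'b set \<Rightarrow> ('a \<Rightarrow> 'b) set \<Rightarrow> bool" where
  "med_family A B \<F> \<longleftrightarrow> ed_family A B \<F> \<and> (\<forall>\<G>. ed_family A B \<G> \<and> \<F> \<subseteq> \<G> \<longrightarrow> \<G> = \<F>)"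

text \<open>Since \<open>n\<close> varies, elements of \<open>B\<^sup>n\<close> are rendered as lists of length \<open>n\<close>.\<close>

definition set_power :: "'b set \<Rightarrow> nat \<Rightarrow> 'b list set" where
  "set_power B n = {xs. length xs = n \<and> set xs \<subseteq> B}"

definition fun_product :: "'a set \<Rightarrow> ('a \<Rightarrow> 'b) list \<Rightarrow> 'a \<Rightarrow> 'b list" where
  "fun_product A fs = (\<lambda>a\<in>A. map (\<lambda>f. f a) fs)"

definition family_power :: "'a set \<Rightarrow> ('a \<Rightarrow> 'b) set \<Rightarrow> nat \<Rightarrow> ('a \<Rightarrow> 'b list) set" where
  "family_power A \<F> n = fun_product A ` set_power \<F> n"

definition I0 :: "'b set \<Rightarrow> (nat \<Rightarrow> 'b) set \<Rightarrow> nat set set" where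
  "I0 B \<F> = {A. infinite A \<and> \<not> med_family A B ((\<lambda>f. restrict f A) ` \<F>)} \<union> {A. finite A}"

definition finitely_I0_productive :: "(nat \<Rightarrow> nat) set \<Rightarrow> bool" where
  "finitely_I0_productive \<F> \<longleftrightarrow> med_family UNIV UNIV \<F> \<and>
     (\<forall>n\<ge>1. I0 (set_power UNIV n) (family_power UNIV \<F> n) = I0 UNIV \<F>)"


section \<open>Ideals on the natural numbers\<close>

definition ideal_on_nat :: "nat set set \<Rightarrow> bool" where
  "ideal_on_nat \<I> \<longleftrightarrow> {} \<in> \<I> \<and> (\<forall>X\<in>\<I>. \<forall>Y. Y \<subseteq> X \<longrightarrow> Y \<in> \<I>) \<and> (\<forall>X\<in>\<I>. \<forall>Y\<in>\<I>. X \<union> Y \<in> \<I>)"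

definition proper_ideal_on_nat :: "nat set set \<Rightarrow> bool" where
  "proper_ideal_on_nat \<I> \<longleftrightarrow> ideal_on_nat \<I> \<and> UNIV \<notin> \<I>"

unbundle no cardinal_syntax

end

theory Submission
  imports Defs "HOL-Library.Countable"
begin

unbundle cardinal_syntax

text \<open>
  The family is built by a transfinite recursion of length continuum whose bookkeeping runs over
  all pairs \<open>(A, gs)\<close> of a set \<open>A\<close> and a list \<open>gs\<close> of functions, the list standing for a map from
  \<open>A\<close> to tuples. Besides members of the family, the recursion collects witnesses: for every \<open>A\<close>
  in the ideal, a function on \<open>A\<close> that is to stay eventually different from all members. Members
  are the total functions and witnesses are partial functions with domain in the ideal, so both
  requirements hold once a single set of partial functions is kept eventually different.

  If \<open>A\<close> lies in the ideal, a witness on \<open>A\<close> is the restriction of a function that is eventually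
  different from the fewer than continuum many partial functions present
  (\<open>MA_eventually_different\<close>). If \<open>A\<close> does not lie in the ideal, the domains of the witnesses
  present do not almost cover \<open>A\<close> by finite unions, so \<open>A\<close> has an infinite subset \<open>B\<close> that is almost
  disjoint from all of them (\<open>MA_almost_disjoint_subset\<close>). On \<open>B\<close> only the members constrain what a
  new member may be. The list \<open>gs\<close> is then hit one coordinate at a time (\<open>extend_total\<close>): either a
  member agrees with the coordinate infinitely often on \<open>B\<close>, and \<open>B\<close> shrinks to the set of
  agreement, or the coordinate is eventually different from every member on \<open>B\<close> and may itself be
  prescribed on \<open>B\<close> for a new member. Treating coordinates separately on a shrinking set is what
  gives one tuple of members that agrees with the whole list infinitely often, hence maximality of
  all finite powers on \<open>A\<close>. For \<open>A\<close> in the ideal, repeating the witness in every coordinate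
  shows that no finite power is maximal on \<open>A\<close>.

  Both uses of Martin's Axiom reduce to one consequence: a family of fewer than continuum many
  subsets of a countable set, all of whose finite intersections are infinite, has an infinite
  pseudo-intersection.
\<close>

section \<open>Pseudo-intersections under Martin's Axiom\<close>

abbreviation below_continuum :: "'a set \<Rightarrow> bool" where
  "below_continuum X \<equiv> |X| <o |UNIV :: nat set set|"

lemma infinite_nat_sets: "infinite (UNIV :: nat set set)"
  by (simp add: Finite_Set.finite_set)

lemma finite_card_less_infinite: "finite A \<Longrightarrow> infinite B \<Longrightarrow> |A| <o |B|"
  by (meson card_of_Well_order card_of_ordLeq_finite not_ordLeq_iff_ordLess)

lemma below_continuum_Un:
  "below_continuum X \<Longrightarrow> below_continuum Y \<Longrightarrow> below_continuum (X \<union> Y)"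
  by (rule card_of_Un_ordLess_infinite[OF infinite_nat_sets])

lemma below_continuum_finite: "finite X \<Longrightarrow> below_continuum X"
  using finite_card_less_infinite infinite_nat_sets by blast

lemma below_continuum_image: "below_continuum X \<Longrightarrow> below_continuum (f ` X)"
  using card_of_image ordLeq_ordLess_trans by blast

lemma below_continuum_mono: "below_continuum Y \<Longrightarrow> X \<subseteq> Y \<Longrightarrow> below_continuum X"
  using card_of_mono1 ordLeq_ordLess_trans by blast

lemma below_continuum_nat: "below_continuum (UNIV :: nat set)"
  using card_of_Pow[of "UNIV :: nat set"] by simp

text \<open>
  The Mathias--Prikry forcing of the filter generated by \<open>\<S>\<close>: a condition \<open>(s, T)\<close> promises that
  \<open>s\<close> is part of the pseudo-intersection and that all further elements lie in \<open>\<Inter>T\<close>. Conditions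
  with the same finite part \<open>s\<close> are compatible, and there are countably many such parts.
\<close>

theorem MA_pseudo_intersection:
  fixes \<S> :: "'a :: countable set set"
  assumes MA: MA_sigma_centered and small: "below_continuum \<S>"
    and sfip: "\<And>T. finite T \<Longrightarrow> T \<subseteq> \<S> \<Longrightarrow> infinite (\<Inter>T)"
  shows "\<exists>C. infinite C \<and> (\<forall>S\<in>\<S>. finite (C - S))"
proof -
  define P where "P = {(s :: 'a set, T). finite s \<and> finite T \<and> T \<subseteq> \<S>}"
  define r where "r = {((s', T'), (s, T)). (s', T') \<in> P \<and> (s, T) \<in> P \<and>
                         s \<subseteq> s' \<and> T \<subseteq> T' \<and> s' - s \<subseteq> \<Inter>T}"
  have rI: "((s', T'), (s, T)) \<in> r"
    if "(s', T') \<in> P" "(s, T) \<in> P" "s \<subseteq> s'" "T \<subseteq> T'" "s' - s \<subseteq> \<Inter>T" for s' T' s T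
    using that by (simp add: r_def)
  have "forcing_notion P r"
    unfolding forcing_notion_def preorder_on_def refl_on_def
  proof (intro conjI)
    show "trans r"
    proof (rule transI)
      fix p q t assume "(p, q) \<in> r" "(q, t) \<in> r"
      then obtain s0 T0 s1 T1 s2 T2 where eq: "p = (s2, T2)" "q = (s1, T1)" "t = (s0, T0)"
        and P: "(s2, T2) \<in> P" "(s0, T0) \<in> P" and s: "s0 \<subseteq> s1" "s1 \<subseteq> s2" and T: "T0 \<subseteq> T1" "T1 \<subseteq> T2"
        and diff: "s1 - s0 \<subseteq> \<Inter>T0" "s2 - s1 \<subseteq> \<Inter>T1"
        by (auto simp: r_def)
      have "s2 - s0 \<subseteq> (s2 - s1) \<union> (s1 - s0)" by blast
      also have "\<dots> \<subseteq> \<Inter>T0" using diff Inter_anti_mono[OF T(1)] by blast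
      finally show "(p, t) \<in> r"
        unfolding eq by (intro rI P order_trans[OF s] order_trans[OF T])
    qed
    have "({}, {}) \<in> P" by (simp add: P_def)
    then show "P \<noteq> {}" by blast
  qed (auto simp: r_def)
  moreover have "sigma_centered P r"
    unfolding sigma_centered_def
  proof (intro exI[of _ "\<lambda>n. {(s, T) \<in> P. s = set (from_nat n)}"] conjI allI)
    show "P = (\<Union>n. {(s, T) \<in> P. s = set (from_nat n)})"
    proof -
      have "\<exists>n. s = set (from_nat n)" if "finite s" for s :: "'a set"
        using that finite_list from_nat_to_nat by metis
      then show ?thesis by (auto simp: P_def)
    qed
    fix n
    let ?s = "set (from_nat n) :: 'a set"
    show "centered P r {(s, T) \<in> P. s = ?s}"
      unfolding centered_def
    proof (intro conjI allI impI)
      fix F assume F: "finite F \<and> F \<subseteq> {(s, T) \<in> P. s = ?s}"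
      have "snd p \<subseteq> \<S> \<and> finite (snd p)" if "p \<in> F" for p
        using F that by (cases p) (auto simp: P_def)
      then have q: "(?s, \<Union>(snd ` F)) \<in> P" using F by (simp add: P_def UN_least)
      have "((?s, \<Union>(snd ` F)), p) \<in> r" if "p \<in> F" for p
      proof -
        obtain s T where "p = (s, T)" by (cases p)
        then have "p = (?s, T)" "(?s, T) \<in> P" using that F by auto
        moreover from this have "T \<subseteq> \<Union>(snd ` F)" using that by force
        ultimately show ?thesis using q by (simp add: rI)
      qed
      then show "\<exists>q\<in>P. \<forall>p\<in>F. (q, p) \<in> r" using q by blast
    qed auto
  qed
  ultimately have "MA_for P r" by (rule MA_sigma_centeredD[OF MA])
  \<comment> \<open>Meeting every \<open>D S\<close> makes the generic set almost contained in \<open>S\<close>; meeting every \<open>E n\<close> makes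
    it infinite.\<close>
  define D where "D S = {(s, T) \<in> P. S \<in> T}" for S
  define E where "E n = {(s, T) \<in> P. n \<le> card s}" for n
  let ?\<D> = "D ` \<S> \<union> range E"
  have "forcing_dense P r (D S)" if "S \<in> \<S>" for S
    unfolding forcing_dense_def
  proof (intro conjI ballI)
    fix p assume "p \<in> P"
    then obtain s T where p: "p = (s, T)" "(s, T) \<in> P" by (cases p) auto
    then have "(s, insert S T) \<in> D S" "((s, insert S T), p) \<in> r"
      using that by (auto simp: D_def P_def r_def)
    then show "\<exists>d\<in>D S. (d, p) \<in> r" by blast
  qed (auto simp: D_def)
  moreover have "forcing_dense P r (E n)" for n
    unfolding forcing_dense_def
  proof (intro conjI ballI)
    fix p assume "p \<in> P"
    then obtain s T where p: "p = (s, T)" "(s, T) \<in> P" by (cases p) auto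
    then have "infinite (\<Inter>T)" using sfip by (simp add: P_def)
    then obtain t where t: "t \<subseteq> \<Inter>T" "card t = n" "finite t"
      using infinite_arbitrarily_large by blast
    then have "n \<le> card (s \<union> t)" using p by (auto simp: P_def intro: card_mono)
    then have "(s \<union> t, T) \<in> E n" "((s \<union> t, T), p) \<in> r"
      using t p by (auto simp: E_def P_def r_def)
    then show "\<exists>d\<in>E n. (d, p) \<in> r" by blast
  qed (auto simp: E_def)
  moreover have "below_continuum ?\<D>"
    by (intro below_continuum_Un below_continuum_image small below_continuum_nat)
  ultimately have "\<exists>G. forcing_filter P r G \<and> (\<forall>D\<in>?\<D>. G \<inter> D \<noteq> {})"
    by (intro \<open>MA_for P r\<close>[unfolded MA_for_def, rule_format]) auto
  then obtain G where G: "forcing_filter P r G" and meets: "\<forall>D\<in>?\<D>. G \<inter> D \<noteq> {}"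
    by (elim exE conjE)
  define C where "C = \<Union>(fst ` G)"
  have "infinite C"
  proof
    assume "finite C"
    have "G \<inter> E (Suc (card C)) \<noteq> {}" using meets by blast
    then obtain s T where "(s, T) \<in> G" "Suc (card C) \<le> card s" by (auto simp: E_def)
    moreover from this have "card s \<le> card C"
      using \<open>finite C\<close> by (intro card_mono) (force simp: C_def)+
    ultimately show False by simp
  qed
  moreover have "finite (C - S)" if "S \<in> \<S>" for S
  proof -
    have "G \<inter> D S \<noteq> {}" using meets that by blast
    then obtain s T where sT: "(s, T) \<in> G" "S \<in> T" "finite s" by (auto simp: D_def P_def)
    have "C - S \<subseteq> s"
    proof
      fix x assume x: "x \<in> C - S"
      then obtain s' T' where "(s', T') \<in> G" "x \<in> s'" by (auto simp: C_def)
      then obtain q where "q \<in> G" "(q, (s', T')) \<in> r" "(q, (s, T)) \<in> r"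
        using G sT(1) unfolding forcing_filter_def by blast
      then show "x \<in> s" using \<open>x \<in> s'\<close> sT(2) x by (auto simp: r_def)
    qed
    then show ?thesis using sT(3) finite_subset by blast
  qed
  ultimately show ?thesis by blast
qed

text \<open>
  The complements of the sets in \<open>\<J>\<close>, together with \<open>A\<close>, have infinite finite intersections, because
  a finite one would put \<open>A\<close> into the ideal; \<open>B\<close> is a pseudo-intersection cut down to \<open>A\<close>.
\<close>

lemma MA_almost_disjoint_subset:
  fixes \<I> :: "nat set set"
  assumes MA: MA_sigma_centered and ideal: "ideal_on_nat \<I>" and Fin: "{A. finite A} \<subseteq> \<I>"
    and A: "A \<notin> \<I>" and \<J>: "\<J> \<subseteq> \<I>" "below_continuum \<J>"
  shows "\<exists>B \<subseteq> A. infinite B \<and> (\<forall>J\<in>\<J>. finite (B \<inter> J))"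
proof -
  have down: "\<And>X Y. X \<in> \<I> \<Longrightarrow> Y \<subseteq> X \<Longrightarrow> Y \<in> \<I>" and un: "\<And>X Y. X \<in> \<I> \<Longrightarrow> Y \<in> \<I> \<Longrightarrow> X \<union> Y \<in> \<I>"
    using ideal by (auto simp: ideal_on_nat_def)
  have "infinite (\<Inter>T)" if T: "finite T" "T \<subseteq> insert A (uminus ` \<J>)" for T
  proof
    assume fin: "finite (\<Inter>T)"
    have "A - \<Inter>T' \<in> \<I>" if "finite T'" "T' \<subseteq> insert A (uminus ` \<J>)" for T'
      using that
    proof (induction T' rule: finite_induct)
      case empty
      then show ?case using ideal by (simp add: ideal_on_nat_def)
    next
      case (insert S T')
      have "A - S \<in> \<I>"
      proof (cases "S = A")
        case True
        then show ?thesis using ideal by (simp add: ideal_on_nat_def)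
      next
        case False
        then obtain J where "J \<in> \<J>" "S = - J" using insert.prems by blast
        then have "J \<in> \<I>" "A - S \<subseteq> J" using \<J>(1) by auto
        then show ?thesis by (rule down)
      qed
      moreover have "A - \<Inter>(insert S T') = (A - S) \<union> (A - \<Inter>T')" by blast
      ultimately show ?case using un insert by auto
    qed
    from this[OF T] have "(A - \<Inter>T) \<union> \<Inter>T \<in> \<I>"
      by (rule un) (use fin Fin in blast)
    then have "A \<in> \<I>" by (rule down) blast
    then show False using A by blast
  qed
  moreover have "below_continuum (insert A (uminus ` \<J>))"
    using below_continuum_Un[OF below_continuum_finite[of "{A}"] below_continuum_image[OF \<J>(2)]] by simp
  ultimately have "\<exists>C. infinite C \<and> (\<forall>S\<in>insert A (uminus ` \<J>). finite (C - S))"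
    by (intro MA_pseudo_intersection[OF MA])
  then obtain C where C: "infinite C" "\<forall>S\<in>insert A (uminus ` \<J>). finite (C - S)"
    by (elim exE conjE)
  have "infinite (C \<inter> A)"
  proof
    assume "finite (C \<inter> A)"
    moreover have "finite (C - A)" using C(2) by blast
    ultimately have "finite ((C \<inter> A) \<union> (C - A))" by blast
    then show False using C(1) by (simp add: Int_Diff_Un)
  qed
  moreover have "finite ((C \<inter> A) \<inter> J)" if "J \<in> \<J>" for J
  proof -
    have "finite (C - (- J))" using C(2) that by blast
    then show ?thesis by (rule rev_finite_subset) auto
  qed
  ultimately show ?thesis by (intro exI[of _ "C \<inter> A"]) auto
qed

text \<open>
  The countable set is that of finite sequences, seen as functions on initial segments. A
  pseudo-intersection \<open>C\<close> of the sets of sequences that avoid a given \<open>u\<close> everywhere, and of those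
  that are longer than \<open>k\<close>, gives sequences almost all of which avoid \<open>u\<close>. The value of \<open>h\<close> at \<open>k\<close> is
  read off a sequence of \<open>C\<close> whose index is at least \<open>k\<close>, so that every sequence is used only finitely
  often, and the finitely many that do not avoid \<open>u\<close> do finite damage.
\<close>

theorem MA_eventually_different:
  fixes X :: "(nat \<rightharpoonup> nat) set"
  assumes MA: MA_sigma_centered and small: "below_continuum X"
  shows "\<exists>h. \<forall>u\<in>X. finite {a. u a = Some (h a)}"
proof -
  define D where "D u = {s. \<forall>a<length s. u a \<noteq> Some (s ! a)}" for u :: "nat \<rightharpoonup> nat"
  define L where "L k = {s :: nat list. k < length s}" for k
  have "infinite (\<Inter>T)" if T: "finite T" "T \<subseteq> D ` X \<union> range L" for T
  proof -
    obtain U where U: "finite U" "U \<subseteq> X" "T \<inter> D ` X = D ` U"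
      using finite_subset_image[of "T \<inter> D ` X" D X] T by auto
    obtain K where K: "finite K" "T \<inter> range L = L ` K"
      using finite_subset_image[of "T \<inter> range L" L UNIV] T by auto
    \<comment> \<open>Finitely many partial functions are avoided everywhere by one function \<open>e\<close>, whose long
      initial segments all lie in \<open>\<Inter>T\<close>.\<close>
    have "\<exists>v. \<forall>u\<in>U. u a \<noteq> Some v" for a
    proof -
      have "finite {v. \<exists>u\<in>U. u a = Some v}"
        by (rule finite_subset[OF _ finite_imageI[OF U(1), of "\<lambda>u. the (u a)"]]) force
      then show ?thesis using ex_new_if_finite[OF infinite_UNIV_nat] by blast
    qed
    then obtain e where e: "\<And>a u. u \<in> U \<Longrightarrow> u a \<noteq> Some (e a)" by metis
    define m where "m = Suc (Max (insert 0 K))"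
    have m: "k < m" if "k \<in> K" for k using that K(1) by (simp add: m_def less_Suc_eq_le)
    have "map e [0..<n] \<in> \<Inter>T" if "m \<le> n" for n
    proof
      fix S assume "S \<in> T"
      then have "S \<in> (T \<inter> D ` X) \<union> (T \<inter> range L)" using T(2) by blast
      then have "S \<in> D ` U \<union> L ` K" unfolding U(3) K(2) .
      then show "map e [0..<n] \<in> S"
      proof
        assume "S \<in> D ` U"
        then show ?thesis using e by (auto simp: D_def)
      next
        assume "S \<in> L ` K"
        then show ?thesis using less_le_trans[OF m that] by (auto simp: L_def)
      qed
    qed
    then have sub: "(\<lambda>n. map e [0..<n]) ` {m..} \<subseteq> \<Inter>T" by auto
    have "inj_on (\<lambda>n. map e [0..<n]) {m..}"
      by (rule inj_on_inverseI[of _ length]) simp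
    then have "infinite ((\<lambda>n. map e [0..<n]) ` {m..})"
      by (simp add: finite_image_iff infinite_Ici)
    with sub show ?thesis by (rule infinite_super)
  qed
  moreover have "below_continuum (D ` X \<union> range L)"
    by (intro below_continuum_Un below_continuum_image small below_continuum_nat)
  ultimately have "\<exists>C. infinite C \<and> (\<forall>S \<in> D ` X \<union> range L. finite (C - S))"
    by (intro MA_pseudo_intersection[OF MA])
  then obtain C where C: "infinite C" "\<forall>S \<in> D ` X \<union> range L. finite (C - S)"
    by (elim exE conjE)
  have "\<exists>s\<in>C. k < length s \<and> k \<le> to_nat s" for k
  proof -
    have "finite {s :: nat list. to_nat s < k}"
      by (rule finite_imageD[of to_nat]) (auto intro: finite_subset[of _ "{..<k}"] inj_on_subset[OF inj_to_nat])
    moreover have "finite (C - L k)" using C(2) by blast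
    ultimately have "infinite (C - (C - L k) - {s. to_nat s < k})"
      using C(1) by (metis Diff_infinite_finite)
    then obtain s where "s \<in> C - (C - L k) - {s. to_nat s < k}"
      using infinite_imp_nonempty by blast
    then show ?thesis by (auto simp: L_def)
  qed
  then obtain s where s: "\<And>k. s k \<in> C" "\<And>k. k < length (s k)" "\<And>k. k \<le> to_nat (s k)" by metis
  have "finite {a. u a = Some (s a ! a)}" if "u \<in> X" for u
  proof -
    have fin: "finite (C - D u)" using C(2) that by blast
    have "{a. u a = Some (s a ! a)} \<subseteq> (\<Union>t \<in> C - D u. {..to_nat t})"
    proof
      fix a assume a: "a \<in> {a. u a = Some (s a ! a)}"
      then have "s a \<notin> D u" using s(2)[of a] by (auto simp: D_def)
      then show "a \<in> (\<Union>t \<in> C - D u. {..to_nat t})" using s(1,3) by auto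
    qed
    then show ?thesis by (rule finite_subset) (use fin in simp)
  qed
  then show ?thesis by (intro exI[of _ "\<lambda>a. s a ! a"]) simp
qed


section \<open>Transfinite bookkeeping\<close>

text \<open>
  A set of elements subject to a condition of finite character can be grown along a well-order of
  the tasks of minimal order type, by finitely many elements for each task. Minimality keeps the set
  built before any task smaller than the set of all tasks, and finite character carries the
  condition through limit stages. The tasks need no enumeration: the recursion runs over the type
  of tasks itself.
\<close>

theorem transfinite_fulfilment:
  fixes good :: "'e set \<Rightarrow> bool" and fulfilled :: "'t \<Rightarrow> 'e set \<Rightarrow> bool"
  assumes inf: "infinite (UNIV :: 't set)"
    and good_empty: "good {}"
    and good_subset: "\<And>X Y. good X \<Longrightarrow> Y \<subseteq> X \<Longrightarrow> good Y"
    and good_finite_char: "\<And>X. (\<And>F. finite F \<Longrightarrow> F \<subseteq> X \<Longrightarrow> good F) \<Longrightarrow> good X"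
    and fulfilled_mono: "\<And>t X Y. fulfilled t X \<Longrightarrow> X \<subseteq> Y \<Longrightarrow> fulfilled t Y"
    and step: "\<And>t X. good X \<Longrightarrow> |X| <o |UNIV :: 't set| \<Longrightarrow>
                 \<exists>Y. finite Y \<and> good (X \<union> Y) \<and> fulfilled t (X \<union> Y)"
  shows "\<exists>X. good X \<and> (\<forall>t. fulfilled t X)"
proof -
  let ?r = "|UNIV :: 't set|"
  have "Well_order ?r" by (rule card_of_Well_order)
  then have lin: "\<And>s t. (s, t) \<in> ?r \<or> (t, s) \<in> ?r" and tr: "trans ?r" and wf: "wf (?r - Id)"
    and refl: "\<And>t. (t, t) \<in> ?r"
    unfolding well_order_on_def linear_order_on_def partial_order_on_def preorder_on_def
      total_on_def refl_on_def by (simp_all add: Field_card_of) metis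
  define U where "U Y t = (\<Union>s \<in> underS ?r t. Y s)" for Y :: "'t \<Rightarrow> 'e set" and t
  \<comment> \<open>A finite subset of the union already lies in the part built up to a single stage, the latest
    one from which it takes an element.\<close>
  have union: "good (\<Union>s\<in>S. Y s)" if S: "\<And>s. s \<in> S \<Longrightarrow> good (U Y s \<union> Y s)" for S Y
  proof (rule good_finite_char)
    fix F assume "finite F" "F \<subseteq> (\<Union>s\<in>S. Y s)"
    then have "F = {} \<or> (\<exists>s\<in>S. F \<subseteq> U Y s \<union> Y s)"
    proof (induction F rule: finite_induct)
      case (insert x F)
      then obtain t where t: "t \<in> S" "x \<in> Y t" by auto
      have "{s. (s, t) \<in> ?r} = insert t (underS ?r t)" for t
        using refl by (auto simp: underS_def)
      then have U: "U Y t \<union> Y t = (\<Union>s \<in> {s. (s, t) \<in> ?r}. Y s)" for t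
        by (auto simp: U_def)
      have mono: "U Y s \<union> Y s \<subseteq> U Y t \<union> Y t" if "(s, t) \<in> ?r" for s t
        unfolding U using transD[OF tr _ that] by blast
      from insert consider "F = {}" | s where "s \<in> S" "F \<subseteq> U Y s \<union> Y s" by auto
      then show ?case
      proof cases
        case 1 then show ?thesis using t by auto
      next
        case 2
        show ?thesis
        proof (cases "(s, t) \<in> ?r")
          case True then show ?thesis using mono[OF True] t 2 by blast
        next
          case False
          then have "(t, s) \<in> ?r" using lin by blast
          from mono[OF this] show ?thesis using t 2 by blast
        qed
      qed
    qed simp
    then show "good F" using good_empty good_subset S by blast
  qed
  have "\<exists>Y. \<forall>t. finite (Y t) \<and> good (U Y t \<union> Y t) \<and> fulfilled t (U Y t \<union> Y t)"
  proof (rule dependent_wf_choice[OF wf])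
    fix Y Z :: "'t \<Rightarrow> 'e set" and t V
    assume eq: "\<And>s. (s, t) \<in> ?r - Id \<Longrightarrow> Y s = Z s"
    have "U Y t = U Z t" using eq by (auto simp: U_def underS_def)
    then show "(finite V \<and> good (U Y t \<union> V) \<and> fulfilled t (U Y t \<union> V)) =
               (finite V \<and> good (U Z t \<union> V) \<and> fulfilled t (U Z t \<union> V))" by simp
  next
    fix t and Y :: "'t \<Rightarrow> 'e set"
    assume IH: "\<And>s. (s, t) \<in> ?r - Id \<Longrightarrow>
                  finite (Y s) \<and> good (U Y s \<union> Y s) \<and> fulfilled s (U Y s \<union> Y s)"
    have "good (U Y t)"
      unfolding U_def by (rule union) (use IH in \<open>auto simp: underS_def\<close>)
    moreover have "|U Y t| <o ?r"
    proof (cases "finite (underS ?r t)")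
      case True
      then have "finite (U Y t)" using IH by (auto simp: U_def underS_def)
      then show ?thesis using inf finite_card_less_infinite by blast
    next
      case False
      have "|Y s| \<le>o |underS ?r t|" if "s \<in> underS ?r t" for s
        using IH[of s] that False finite_card_less_infinite ordLess_imp_ordLeq
        by (auto simp: underS_def) 
      then have "|U Y t| \<le>o |underS ?r t|"
        unfolding U_def by (intro card_of_UNION_ordLeq_infinite[OF False] ordLeq_refl ballI card_of_Card_order)
      moreover have "|underS ?r t| <o ?r"
        by (rule card_of_underS[OF card_of_Card_order]) (simp add: Field_card_of)
      ultimately show ?thesis by (rule ordLeq_ordLess_trans)
    qed
    ultimately show "\<exists>V. finite V \<and> good (U Y t \<union> V) \<and> fulfilled t (U Y t \<union> V)"
      by (rule step)
  qed
  then obtain Y where Y: "\<And>t. good (U Y t \<union> Y t)" "\<And>t. fulfilled t (U Y t \<union> Y t)" by blast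
  have "good (\<Union>t\<in>UNIV. Y t)" by (rule union) (rule Y)
  moreover have "fulfilled t (\<Union>t\<in>UNIV. Y t)" for t
    by (rule fulfilled_mono[OF Y(2)]) (auto simp: U_def)
  ultimately show ?thesis by blast
qed


section \<open>Eventually different families of partial functions\<close>

text \<open>
  The total functions in \<open>X\<close> will be the family; the partial ones with domain \<open>A \<in> \<I>\<close> witness that
  the family is not maximal on \<open>A\<close>.
\<close>

definition ed_partial :: "nat set set \<Rightarrow> (nat \<rightharpoonup> nat) set \<Rightarrow> bool" where
  "ed_partial \<I> X \<longleftrightarrow> (\<forall>u\<in>X. dom u = UNIV \<or> dom u \<in> \<I>) \<and>
     pairwise (\<lambda>u v. finite {a \<in> dom u. u a = v a}) X"

lemma ed_partial_insert:
  assumes "ed_partial \<I> X" "dom u = UNIV \<or> dom u \<in> \<I>"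
    and "\<And>v. v \<in> X \<Longrightarrow> finite {a \<in> dom u. u a = v a}"
  shows "ed_partial \<I> (insert u X)"
proof -
  have "{a \<in> dom v. v a = u a} = {a \<in> dom u. u a = v a}" for v
    by (rule Collect_cong) (unfold domIff, metis)
  then have "finite {a \<in> dom v. v a = u a}" if "v \<in> X" for v
    using assms(3)[OF that] by simp
  then show ?thesis using assms by (auto simp: ed_partial_def pairwise_insert)
qed

text \<open>
  If no total member agrees with \<open>g\<close> infinitely often on \<open>B\<close>, the new member copies \<open>g\<close> on \<open>B\<close> and is
  elsewhere a function that is eventually different from all of \<open>X\<close>. On \<open>B\<close> this is harmless:
  total members agree with \<open>g\<close> there only finitely often, and the domains of the others barely
  meet \<open>B\<close>.
\<close>

lemma extend_total:
  fixes g :: "nat \<Rightarrow> nat"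
  assumes MA: MA_sigma_centered
    and X: "ed_partial \<I> X" "below_continuum X"
    and B: "infinite B" "\<And>u. u \<in> X \<Longrightarrow> dom u \<in> \<I> \<Longrightarrow> finite (B \<inter> dom u)"
  shows "\<exists>f. ed_partial \<I> (insert (Some \<circ> f) X) \<and> infinite {a \<in> B. f a = g a}"
proof (cases "\<exists>f. Some \<circ> f \<in> X \<and> infinite {a \<in> B. f a = g a}")
  case True
  then show ?thesis using X(1) by (metis insert_absorb)
next
  case False
  from MA_eventually_different[OF MA X(2)]
  obtain h where h: "\<forall>u\<in>X. finite {a. u a = Some (h a)}" by (elim exE)
  define f where "f a = (if a \<in> B then g a else h a)" for a
  have "finite {a \<in> dom (Some \<circ> f). (Some \<circ> f) a = u a}" if "u \<in> X" for u
  proof -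
    have "finite {a \<in> B. u a = Some (g a)}"
    proof (cases "dom u = UNIV")
      case True
      have "Some \<circ> (\<lambda>a. the (u a)) = u"
      proof
        fix a
        have "a \<in> dom u" using True by simp
        then show "(Some \<circ> (\<lambda>a. the (u a))) a = u a" by auto
      qed
      then have "Some \<circ> (\<lambda>a. the (u a)) \<in> X" using that by (simp only:)
      then have "finite {a \<in> B. the (u a) = g a}" using False by blast
      then show ?thesis by (rule rev_finite_subset) auto
    next
      case False
      then have "dom u \<in> \<I>" using X(1) that unfolding ed_partial_def by blast
      then have "finite (B \<inter> dom u)" by (rule B(2)[OF that])
      then show ?thesis by (rule rev_finite_subset) auto
    qed
    then have "finite ({a \<in> B. u a = Some (g a)} \<union> {a. u a = Some (h a)})" using h that by simp
    then show ?thesis by (rule rev_finite_subset) (auto simp: f_def split: if_splits)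
  qed
  then have "ed_partial \<I> (insert (Some \<circ> f) X)" by (intro ed_partial_insert X(1)) auto
  moreover have "{a \<in> B. f a = g a} = B" by (auto simp: f_def)
  ultimately show ?thesis using B(1) by auto
qed

text \<open>
  Each coordinate shrinks \<open>B\<close> to the infinite set on which it has been hit. New members are total, and
  \<open>UNIV \<notin> \<I>\<close>, so they leave the hypothesis on domains in \<open>\<I>\<close> intact.
\<close>

lemma extend_total_list:
  assumes MA: MA_sigma_centered and proper: "UNIV \<notin> \<I>"
    and "ed_partial \<I> X" "below_continuum X"
    and "infinite B" "\<And>u. u \<in> X \<Longrightarrow> dom u \<in> \<I> \<Longrightarrow> finite (B \<inter> dom u)"
  shows "\<exists>fs. length fs = length gs \<and> ed_partial \<I> (X \<union> (\<lambda>f. Some \<circ> f) ` set fs) \<and>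
           infinite {a \<in> B. map (\<lambda>f. f a) fs = map (\<lambda>g. g a) gs}"
  using assms(3-)
proof (induction gs arbitrary: X B)
  case Nil
  then show ?case by auto
next
  case (Cons g gs)
  obtain f where f: "ed_partial \<I> (insert (Some \<circ> f) X)" "infinite {a \<in> B. f a = g a}"
    using extend_total[OF MA Cons.prems] by blast
  have "below_continuum (insert (Some \<circ> f) X)"
    using below_continuum_Un[OF below_continuum_finite[of "{Some \<circ> f}"] Cons.prems(2)] by simp
  moreover have "finite ({a \<in> B. f a = g a} \<inter> dom u)" if "u \<in> insert (Some \<circ> f) X" "dom u \<in> \<I>" for u
  proof -
    have "dom (Some \<circ> f) = UNIV" by auto
    then have "u \<in> X" using that proper by auto
    then have "finite (B \<inter> dom u)" using Cons.prems(4) that(2) by blast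
    then show ?thesis by (rule rev_finite_subset) auto
  qed
  ultimately obtain fs where fs: "length fs = length gs"
      "ed_partial \<I> (insert (Some \<circ> f) X \<union> (\<lambda>f. Some \<circ> f) ` set fs)"
      "infinite {a \<in> {a \<in> B. f a = g a}. map (\<lambda>f. f a) fs = map (\<lambda>g. g a) gs}"
    using Cons.IH[OF f(1) _ f(2)] by blast
  show ?case
    by (rule exI[of _ "f # fs"]) (use fs in \<open>simp add: conj_assoc comp_def\<close>)
qed

text \<open>
  A task \<open>(A, gs)\<close> stands for the map \<open>a \<mapsto> (g\<^sub>1 a, \<dots>, g\<^sub>n a)\<close> on \<open>A\<close>. For \<open>A \<in> \<I>\<close> the
  task asks only for a witness on \<open>A\<close>, which \<open>ed_partial\<close> then keeps eventually different from
  the family.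
\<close>

definition fulfils :: "nat set set \<Rightarrow> nat set \<times> (nat \<Rightarrow> nat) list \<Rightarrow> (nat \<rightharpoonup> nat) set \<Rightarrow> bool" where
  "fulfils \<I> = (\<lambda>(A, gs) X.
     if A \<in> \<I> then \<exists>u\<in>X. dom u = A
     else \<exists>fs. length fs = length gs \<and> (\<lambda>f. Some \<circ> f) ` set fs \<subseteq> X \<and>
            infinite {a \<in> A. map (\<lambda>f. f a) fs = map (\<lambda>g. g a) gs})"

lemma fulfil_step:
  assumes MA: MA_sigma_centered and ideal: "proper_ideal_on_nat \<I>" and Fin: "{A. finite A} \<subseteq> \<I>"
    and X: "ed_partial \<I> X" "below_continuum X"
  shows "\<exists>Y. finite Y \<and> ed_partial \<I> (X \<union> Y) \<and> fulfils \<I> (A, gs) (X \<union> Y)"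
proof (cases "A \<in> \<I>")
  case True
  from MA_eventually_different[OF MA X(2)]
  obtain h where h: "\<forall>u\<in>X. finite {a. u a = Some (h a)}" by (elim exE)
  let ?u = "(Some \<circ> h) |` A"
  have dom: "dom ?u = A" by auto
  have "ed_partial \<I> (insert ?u X)"
  proof (rule ed_partial_insert[OF X(1)])
    show "finite {a \<in> dom ?u. ?u a = v a}" if "v \<in> X" for v
      by (rule finite_subset[OF _ bspec[OF h that]]) (auto simp: restrict_map_def)
  qed (use dom True in simp)
  then show ?thesis
    using True dom by (intro exI[of _ "{?u}"]) (auto simp: fulfils_def)
next
  case False
  let ?\<J> = "dom ` X \<inter> \<I>"
  have \<I>: "ideal_on_nat \<I>" "UNIV \<notin> \<I>" using ideal by (simp_all add: proper_ideal_on_nat_def)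
  have "below_continuum ?\<J>"
    by (rule below_continuum_mono[OF below_continuum_image[OF X(2)]]) (rule Int_lower1)
  from MA_almost_disjoint_subset[OF MA \<I>(1) Fin False Int_lower2 this]
  obtain B where B: "B \<subseteq> A" "infinite B" "\<forall>J\<in>?\<J>. finite (B \<inter> J)"
    by (elim exE conjE)
  have "\<exists>fs. length fs = length gs \<and> ed_partial \<I> (X \<union> (\<lambda>f. Some \<circ> f) ` set fs) \<and>
          infinite {a \<in> B. map (\<lambda>f. f a) fs = map (\<lambda>g. g a) gs}"
    by (rule extend_total_list[OF MA \<I>(2) X B(2)]) (use B(3) in blast)
  then obtain fs where fs: "length fs = length gs" "ed_partial \<I> (X \<union> (\<lambda>f. Some \<circ> f) ` set fs)"
      "infinite {a \<in> B. map (\<lambda>f. f a) fs = map (\<lambda>g. g a) gs}"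
    by (elim exE conjE)
  have "{a \<in> B. map (\<lambda>f. f a) fs = map (\<lambda>g. g a) gs} \<subseteq> {a \<in> A. map (\<lambda>f. f a) fs = map (\<lambda>g. g a) gs}"
    using B(1) by blast
  then have "infinite {a \<in> A. map (\<lambda>f. f a) fs = map (\<lambda>g. g a) gs}"
    using fs(3) infinite_super by blast
  then show ?thesis
    unfolding fulfils_def using fs(1,2) False
    by (intro exI[of _ "(\<lambda>f. Some \<circ> f) ` set fs"]) auto
qed

text \<open>
  A task is coded by the set \<open>A\<close> together with the graph of \<open>k \<mapsto> (g\<^sub>1 k, \<dots>, g\<^sub>n k)\<close>, a subset of a
  countable set.
\<close>

lemma card_of_tasks: "|UNIV :: (nat set \<times> (nat \<Rightarrow> nat) list) set| \<le>o |UNIV :: nat set set|"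
proof (rule card_of_ordLeqI)
  define code :: "nat set \<times> (nat \<Rightarrow> nat) list \<Rightarrow> nat set" where
    "code = (\<lambda>(A, gs). to_nat ` (Inl ` A \<union> Inr ` range (\<lambda>k. (k, map (\<lambda>g. g k) gs))))"
  show "inj_on code UNIV"
  proof (rule injI, clarify)
    fix A A' :: "nat set" and gs gs' :: "(nat \<Rightarrow> nat) list"
    assume "code (A, gs) = code (A', gs')"
    then have eq: "Inl ` A \<union> Inr ` range (\<lambda>k. (k, map (\<lambda>g. g k) gs)) =
               Inl ` A' \<union> Inr ` range (\<lambda>k. (k, map (\<lambda>g. g k) gs'))"
      by (simp add: code_def inj_image_eq_iff)
    then have "a \<in> A \<longleftrightarrow> a \<in> A'" for a
      by (auto simp: set_eq_iff image_iff dest: spec[of _ "Inl a"])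
    moreover have vals: "map (\<lambda>g. g k) gs = map (\<lambda>g. g k) gs'" for k
    proof -
      have "Inr (k, map (\<lambda>g. g k) gs) \<in> Inl ` A' \<union> Inr ` range (\<lambda>k. (k, map (\<lambda>g. g k) gs'))"
        unfolding eq[symmetric] by blast
      then show ?thesis by auto
    qed
    moreover have "gs = gs'"
    proof (rule nth_equalityI)
      show len: "length gs = length gs'" using vals[of 0] by (metis length_map)
      show "gs ! i = gs' ! i" if "i < length gs" for i
      proof
        fix k
        have "map (\<lambda>g. g k) gs ! i = map (\<lambda>g. g k) gs' ! i" using vals by simp
        then show "(gs ! i) k = (gs' ! i) k" using that len by simp
      qed
    qed
    ultimately show "A = A' \<and> gs = gs'" by blast
  qed
qed simp

theorem fulfilling_family:
  assumes MA: MA_sigma_centered and ideal: "proper_ideal_on_nat \<I>" and Fin: "{A. finite A} \<subseteq> \<I>"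
  shows "\<exists>X. ed_partial \<I> X \<and> (\<forall>t. fulfils \<I> t X)"
proof (rule transfinite_fulfilment)
  show "infinite (UNIV :: (nat set \<times> (nat \<Rightarrow> nat) list) set)"
    by (simp add: finite_prod infinite_nat_sets)
  show "ed_partial \<I> {}" by (simp add: ed_partial_def)
  show "ed_partial \<I> Y" if "ed_partial \<I> X" "Y \<subseteq> X" for X Y
    using that unfolding ed_partial_def by (meson pairwise_subset subsetD)
  show "ed_partial \<I> X" if F: "\<And>F. finite F \<Longrightarrow> F \<subseteq> X \<Longrightarrow> ed_partial \<I> F" for X
    unfolding ed_partial_def
  proof (intro conjI ballI pairwiseI)
    show "dom u = UNIV \<or> dom u \<in> \<I>" if "u \<in> X" for u
      using F[of "{u}"] that by (simp add: ed_partial_def)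
    show "finite {a \<in> dom u. u a = v a}" if "u \<in> X" "v \<in> X" "u \<noteq> v" for u v
      using F[of "{u, v}"] that by (simp add: ed_partial_def pairwise_insert)
  qed
  show "fulfils \<I> t Y" if "fulfils \<I> t X" "X \<subseteq> Y" for t X Y
    using that by (cases t) (auto simp: fulfils_def split: if_splits)
  show "\<exists>Y. finite Y \<and> ed_partial \<I> (X \<union> Y) \<and> fulfils \<I> t (X \<union> Y)"
    if "ed_partial \<I> X" "|X| <o |UNIV :: (nat set \<times> (nat \<Rightarrow> nat) list) set|" for t X
  proof (cases t)
    case (Pair A gs)
    show ?thesis
      unfolding Pair
      by (rule fulfil_step[OF MA ideal Fin that(1) ordLess_ordLeq_trans[OF that(2) card_of_tasks]])
  qed
qed


section \<open>The associated ideal of the total members\<close>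

text \<open>
  On an infinite domain a function is not eventually different from itself, so a function that is
  eventually different from all of \<open>K\<close> properly extends \<open>K\<close>.
\<close>

lemma med_family_iff:
  assumes A: "infinite A" and K: "ed_family A B K"
  shows "med_family A B K \<longleftrightarrow> (\<forall>g \<in> A \<rightarrow>\<^sub>E B. \<exists>f\<in>K. infinite (agree_set A f g))"
proof
  assume med: "med_family A B K"
  show "\<forall>g \<in> A \<rightarrow>\<^sub>E B. \<exists>f\<in>K. infinite (agree_set A f g)"
  proof (rule ballI, rule ccontr)
    fix g assume g: "g \<in> A \<rightarrow>\<^sub>E B" "\<not> (\<exists>f\<in>K. infinite (agree_set A f g))"
    have "agree_set A f g = agree_set A g f" for f by (auto simp: agree_set_def)
    then have "ed_family A B (insert g K)"
      using K g by (auto simp: ed_family_def pairwise_insert eventually_different_def)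
    then have "g \<in> K" using med by (auto simp: med_family_def)
    then show False using g(2) A by (auto simp: agree_set_def)
  qed
next
  assume hit: "\<forall>g \<in> A \<rightarrow>\<^sub>E B. \<exists>f\<in>K. infinite (agree_set A f g)"
  show "med_family A B K"
    unfolding med_family_def
  proof (intro conjI K allI impI)
    fix G assume G: "ed_family A B G \<and> K \<subseteq> G"
    have "g \<in> K" if "g \<in> G" for g
    proof -
      obtain f where "f \<in> K" "infinite (agree_set A f g)"
        using hit G \<open>g \<in> G\<close> unfolding ed_family_def by blast
      then have "f = g"
        using G \<open>g \<in> G\<close> unfolding ed_family_def eventually_different_def pairwise_def by blast
      then show ?thesis using \<open>f \<in> K\<close> by simp
    qed
    then show "G = K" using G by blast
  qed
qed

lemma ed_family_restrict:
  assumes "ed_family UNIV B K"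
  shows "ed_family A B ((\<lambda>f. restrict f A) ` K)"
  unfolding ed_family_def
proof (intro conjI pairwiseI)
  show "(\<lambda>f. restrict f A) ` K \<subseteq> A \<rightarrow>\<^sub>E B"
    using assms by (auto simp: ed_family_def PiE_iff subset_iff)
  fix x y assume "x \<in> (\<lambda>f. restrict f A) ` K" "y \<in> (\<lambda>f. restrict f A) ` K" "x \<noteq> y"
  then obtain f g where fg: "f \<in> K" "g \<in> K" "x = restrict f A" "y = restrict g A" "f \<noteq> g" by blast
  then have "finite (agree_set UNIV f g)"
    using assms unfolding ed_family_def pairwise_def eventually_different_def by blast
  then show "eventually_different A x y"
    unfolding eventually_different_def
    by (rule rev_finite_subset) (auto simp: fg agree_set_def)
qed

text \<open>
  Two different lists differ in some coordinate, and the products agree at most where the members in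
  that coordinate do.
\<close>

lemma ed_family_power:
  assumes "ed_family UNIV UNIV \<F>"
  shows "ed_family UNIV (set_power UNIV n) (family_power UNIV \<F> n)"
  unfolding ed_family_def
proof (intro conjI pairwiseI)
  show "family_power UNIV \<F> n \<subseteq> UNIV \<rightarrow>\<^sub>E set_power UNIV n"
    by (auto simp: family_power_def fun_product_def set_power_def)
  fix x y assume "x \<in> family_power UNIV \<F> n" "y \<in> family_power UNIV \<F> n" "x \<noteq> y"
  then obtain fs gs where fs: "length fs = n" "set fs \<subseteq> \<F>" "x = fun_product UNIV fs"
    and gs: "length gs = n" "set gs \<subseteq> \<F>" "y = fun_product UNIV gs" and "fs \<noteq> gs"
    by (auto simp: family_power_def set_power_def)
  then obtain i where i: "i < n" "fs ! i \<noteq> gs ! i" by (metis nth_equalityI)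
  have "fs ! i \<in> \<F>" "gs ! i \<in> \<F>" using fs gs i(1) by auto
  with i(2) have "finite (agree_set UNIV (fs ! i) (gs ! i))"
    using assms unfolding ed_family_def pairwise_def eventually_different_def by blast
  then show "eventually_different UNIV x y"
    unfolding eventually_different_def
  proof (rule rev_finite_subset)
    show "agree_set UNIV x y \<subseteq> agree_set UNIV (fs ! i) (gs ! i)"
      using fs gs i by (auto simp: agree_set_def fun_product_def) (metis nth_map)
  qed
qed

lemma I0_eqI:
  assumes Fin: "{A. finite A} \<subseteq> \<I>" and K: "ed_family UNIV B K"
    and escape: "\<And>A. A \<in> \<I> \<Longrightarrow> \<exists>g \<in> UNIV \<rightarrow> B. \<forall>f\<in>K. finite {a \<in> A. f a = g a}"
    and hit: "\<And>A g. A \<notin> \<I> \<Longrightarrow> g \<in> A \<rightarrow> B \<Longrightarrow> \<exists>f\<in>K. infinite {a \<in> A. f a = g a}"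
  shows "I0 B K = \<I>"
proof -
  have agree: "agree_set A (restrict f A) g = {a \<in> A. f a = g a}" for A and f g :: "nat \<Rightarrow> 'a"
    by (auto simp: agree_set_def)
  have "med_family A B ((\<lambda>f. restrict f A) ` K) \<longleftrightarrow> A \<notin> \<I>" if A: "infinite A" for A
    unfolding med_family_iff[OF A ed_family_restrict[OF K]]
  proof
    assume med: "\<forall>g \<in> A \<rightarrow>\<^sub>E B. \<exists>f \<in> (\<lambda>f. restrict f A) ` K. infinite (agree_set A f g)"
    show "A \<notin> \<I>"
    proof
      assume "A \<in> \<I>"
      then obtain g where g: "g \<in> UNIV \<rightarrow> B" "\<forall>f\<in>K. finite {a \<in> A. f a = g a}" using escape by blast
      then have "restrict g A \<in> A \<rightarrow>\<^sub>E B" by auto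
      then obtain f where "f \<in> K" "infinite (agree_set A (restrict f A) (restrict g A))"
        using med by blast
      moreover have "agree_set A (restrict f A) (restrict g A) = {a \<in> A. f a = g a}"
        by (auto simp: agree_set_def)
      ultimately show False using g(2) by simp
    qed
  next
    assume "A \<notin> \<I>"
    then show "\<forall>g \<in> A \<rightarrow>\<^sub>E B. \<exists>f \<in> (\<lambda>f. restrict f A) ` K. infinite (agree_set A f g)"
      using hit[of A] by (simp add: agree PiE_iff Pi_iff)
  qed
  then show ?thesis using Fin by (auto simp: I0_def)
qed

theorem theorem3p3:
  fixes \<I> :: "nat set set"
  assumes "MA_sigma_centered"
    and "proper_ideal_on_nat \<I>"
    and "{A. finite A} \<subseteq> \<I>"
  shows "\<exists>\<F> :: (nat \<Rightarrow> nat) set.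
           finitely_I0_productive \<F> \<and> med_family UNIV UNIV \<F> \<and> I0 UNIV \<F> = \<I>"
proof -
  obtain X where X: "ed_partial \<I> X" "\<And>t. fulfils \<I> t X" using fulfilling_family[OF assms] by blast
  have proper: "UNIV \<notin> \<I>" using assms(2) by (simp add: proper_ideal_on_nat_def)
  define \<F> where "\<F> = {f. Some \<circ> f \<in> X}"
  have "ed_family UNIV UNIV \<F>"
    unfolding ed_family_def eventually_different_def agree_set_def
  proof (intro conjI pairwiseI)
    fix f g assume "f \<in> \<F>" "g \<in> \<F>" "f \<noteq> g"
    moreover from \<open>f \<noteq> g\<close> have "Some \<circ> f \<noteq> Some \<circ> g" by (metis comp_apply ext option.inject)
    ultimately have "finite {a \<in> dom (Some \<circ> f). (Some \<circ> f) a = (Some \<circ> g) a}"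
      using X(1) unfolding \<F>_def ed_partial_def pairwise_def by blast
    then show "finite {a \<in> UNIV. f a = g a}" by (rule rev_finite_subset) auto
  qed auto
  have escape: "\<exists>g. \<forall>f\<in>\<F>. finite {a \<in> A. f a = g a}" if "A \<in> \<I>" for A
  proof -
    have "\<exists>u\<in>X. dom u = A" using X(2)[of "(A, [])"] that by (simp add: fulfils_def)
    then obtain u where u: "u \<in> X" "dom u = A" by blast
    have fin: "finite {a \<in> A. f a = the (u a)}" if "f \<in> \<F>" for f
    proof -
      have "dom (Some \<circ> f) = UNIV" by auto
      then have "u \<noteq> Some \<circ> f" using u(2) \<open>A \<in> \<I>\<close> proper by auto
      then have "finite {a \<in> dom u. u a = (Some \<circ> f) a}"
        using X(1) u(1) that unfolding \<F>_def ed_partial_def pairwise_def by blast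
      then show ?thesis by (rule rev_finite_subset) (use u(2) in auto)
    qed
    show ?thesis by (intro exI[of _ "\<lambda>a. the (u a)"] ballI fin)
  qed
  have hit: "\<exists>fs. length fs = length gs \<and> set fs \<subseteq> \<F> \<and>
               infinite {a \<in> A. map (\<lambda>f. f a) fs = map (\<lambda>g. g a) gs}" if "A \<notin> \<I>" for A gs
    using X(2)[of "(A, gs)"] that by (auto simp: fulfils_def \<F>_def)
  have I0: "I0 UNIV \<F> = \<I>"
  proof (rule I0_eqI[OF assms(3) \<open>ed_family UNIV UNIV \<F>\<close>])
    show "\<exists>g \<in> UNIV \<rightarrow> UNIV. \<forall>f\<in>\<F>. finite {a \<in> A. f a = g a}" if "A \<in> \<I>" for A
      using escape[OF that] by auto
    show "\<exists>f\<in>\<F>. infinite {a \<in> A. f a = g a}" if "A \<notin> \<I>" for A g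
      using hit[OF that, of "[g]"] by (auto simp: length_Suc_conv)
  qed
  have "I0 (set_power UNIV n) (family_power UNIV \<F> n) = \<I>" if "n \<ge> 1" for n
  proof (rule I0_eqI[OF assms(3) ed_family_power[OF \<open>ed_family UNIV UNIV \<F>\<close>]])
    fix A assume "A \<in> \<I>"
    then obtain g where g: "\<forall>f\<in>\<F>. finite {a \<in> A. f a = g a}" using escape by blast
    \<comment> \<open>For \<open>n \<ge> 1\<close> the first coordinate alone keeps a product away from the repeated witness.\<close>
    have "finite {a \<in> A. x a = replicate n (g a)}" if x: "x \<in> family_power UNIV \<F> n" for x
    proof -
      obtain fs where fs: "length fs = n" "set fs \<subseteq> \<F>" "x = fun_product UNIV fs"
        using x by (auto simp: family_power_def set_power_def)
      then obtain f fs' where "fs = f # fs'" using \<open>n \<ge> 1\<close> by (cases fs) auto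
      then have "{a \<in> A. x a = replicate n (g a)} \<subseteq> {a \<in> A. f a = g a}" "f \<in> \<F>"
        using fs \<open>n \<ge> 1\<close> by (auto simp: fun_product_def)
      then show ?thesis using g finite_subset by blast
    qed
    then show "\<exists>g \<in> UNIV \<rightarrow> set_power UNIV n. \<forall>x \<in> family_power UNIV \<F> n. finite {a \<in> A. x a = g a}"
      by (intro bexI[of _ "\<lambda>a. replicate n (g a)"]) (auto simp: set_power_def)
  next
    fix A and w :: "nat \<Rightarrow> nat list" assume A: "A \<notin> \<I>" and w: "w \<in> A \<rightarrow> set_power UNIV n"
    let ?gs = "map (\<lambda>i a. w a ! i) [0..<n]"
    obtain fs where fs: "length fs = n" "set fs \<subseteq> \<F>"
        "infinite {a \<in> A. map (\<lambda>f. f a) fs = map (\<lambda>g. g a) ?gs}"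
      using hit[OF A, of ?gs] by auto
    have "map (\<lambda>g. g a) ?gs = w a" if "a \<in> A" for a
      using w that by (auto simp: set_power_def Pi_iff intro!: nth_equalityI)
    then have "{a \<in> A. fun_product UNIV fs a = w a} = {a \<in> A. map (\<lambda>f. f a) fs = map (\<lambda>g. g a) ?gs}"
      by (auto simp: fun_product_def)
    moreover have "fun_product UNIV fs \<in> family_power UNIV \<F> n"
      using fs by (auto simp: family_power_def set_power_def)
    ultimately show "\<exists>x \<in> family_power UNIV \<F> n. infinite {a \<in> A. x a = w a}"
      using fs(3) by metis
  qed
  moreover have "med_family UNIV UNIV \<F>"
  proof -
    have "UNIV \<notin> I0 UNIV \<F>" using I0 proper by simp
    moreover have "restrict f UNIV = f" for f :: "nat \<Rightarrow> nat" by (simp add: restrict_def)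
    ultimately show ?thesis by (simp add: I0_def)
  qed
  ultimately show ?thesis using I0 unfolding finitely_I0_productive_def by blast
qed

unbundle no cardinal_syntax

end
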